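(* Let $S$ be a commutative ai-semiring and let $\Sigma$ be an equational basis for $S$ that contains an infinite subset of $\Omega_1=\{\sigma_{n,1}\mid n\ge 2\}$. If $\mathbf{u}_{m,1}$ is $\mathbf{t}$-free for every inequality $\mathbf{s}\preceq\mathbf{t}$ in $\Sigma\setminus\Omega_1$ and for every $m\ge 4$, then $S$ is nonfinitely based.
   Context: An ai-semiring is an algebra $(S,+,\cdot)$ with $(S,+)$ a commutative idempotent semigroup, $(S,\cdot)$ a semigroup, and multiplication distributing over addition on both sides; it is commutative if $\cdot$ is commutative. $X$ is a countably infinite set of variables, whose members include the pairwise distinct variables $x_1,x_2,\dots,y_1,y_2,\dots$. $X_c^+$ is the free commutative semigroup over $X$ (its elements are words). Commutative terms are finite nonempty subsets of $X_c^+$, written as formal sums; they form the free commutative ai-semiring $P_f(X_c^+)$ under union and elementwise product. A substitution is an endomorphism of $P_f(X_c^+)$. For terms $\mathbf{s},\mathbf{t}$, the inequality $\mathbf{s}\preceq\mathbf{t}$ denotes the identity $\mathbf{t}\approx\mathbf{t}+\mathbf{s}$; an identity $\mathbf{s}\approx\mathbf{t}$ is equivalent to the two inequalities $\mathbf{s}\preceq\mathbf{t}$ and $\mathbf{t}\preceq\mathbf{s}$, so sets of identities are regarded as sets of inequalities. An equational basis for a commutative ai-semiring $S$ is a set $\Sigma$ of such inequalities such that the commutative ai-semirings satisfying $\Sigma$ are exactly the members of the variety $\mathsf{V}(S)$ generated by $S$. $S$ is nonfinitely based if $\mathsf{V}(S)$ is not defined by any finite set of identities. A term $\mathbf{v}$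 is $\mathbf{u}$-free if there are no substitution $\varphi$, no $\mathbf{p}$ that is a term or the empty word (multiplicative identity), and no $\mathbf{r}$ that is a term or the empty set (additive identity) with $\mathbf{v}=\mathbf{p}\varphi(\mathbf{u})+\mathbf{r}$. For $n\ge1$, $\mathbf{u}_{n,1}=\prod_{i=1}^n x_i+x_1x_{n+1}+\sum_{i=2}^n x_iy_ix_{n+1}$, $\mathbf{q}_n=\prod_{i=1}^{n+1}x_i$, and $\sigma_{n,1}$ is the inequality $\mathbf{q}_n\preceq\mathbf{u}_{n,1}$. *)

theory Defs
  imports "HOL-Library.Multiset" "HOL-Library.FuncSet" "HOL-Library.Infinite_Typeclass"
begin

section \<open>Commutative ai-semirings\<close>

record 'a sr =
  carrier :: "'a set"
  add :: "'a \<Rightarrow> 'a \<Rightarrow> 'a"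
  mult :: "'a \<Rightarrow> 'a \<Rightarrow> 'a"

locale ai_semiring =
  fixes S :: "'a sr"
  assumes nonempty: "carrier S \<noteq> {}"
    and add_closed: "\<lbrakk>a \<in> carrier S; b \<in> carrier S\<rbrakk> \<Longrightarrow> add S a b \<in> carrier S"
    and mult_closed: "\<lbrakk>a \<in> carrier S; b \<in> carrier S\<rbrakk> \<Longrightarrow> mult S a b \<in> carrier S"
    and add_assoc: "\<lbrakk>a \<in> carrier S; b \<in> carrier S; c \<in> carrier S\<rbrakk>
      \<Longrightarrow> add S (add S a b) c = add S a (add S b c)"
    and add_comm: "\<lbrakk>a \<in> carrier S; b \<in> carrier S\<rbrakk> \<Longrightarrow> add S a b = add S b a"
    and add_idem: "a \<in> carrier S \<Longrightarrow> add S a a = a"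
    and mult_assoc: "\<lbrakk>a \<in> carrier S; b \<in> carrier S; c \<in> carrier S\<rbrakk>
      \<Longrightarrow> mult S (mult S a b) c = mult S a (mult S b c)"
    and distrib_left: "\<lbrakk>a \<in> carrier S; b \<in> carrier S; c \<in> carrier S\<rbrakk>
      \<Longrightarrow> mult S a (add S b c) = add S (mult S a b) (mult S a c)"
    and distrib_right: "\<lbrakk>a \<in> carrier S; b \<in> carrier S; c \<in> carrier S\<rbrakk>
      \<Longrightarrow> mult S (add S a b) c = add S (mult S a c) (mult S b c)"

locale comm_ai_semiring = ai_semiring +
  assumes mult_comm: "\<lbrakk>a \<in> carrier S; b \<in> carrier S\<rbrakk> \<Longrightarrow> mult S a b = mult S b a"

definition sr_hom :: "'a sr \<Rightarrow> 'b sr \<Rightarrow> ('a \<Rightarrow> 'b) set" where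
  "sr_hom S T = {h. h \<in> carrier S \<rightarrow> carrier T \<and>
     (\<forall>a\<in>carrier S. \<forall>b\<in>carrier S.
        h (add S a b) = add T (h a) (h b) \<and> h (mult S a b) = mult T (h a) (h b))}"

section \<open>Terms and substitutions\<close>

text \<open>The countably infinite set \<open>X\<close> of variables; \<open>x\<^sub>i\<close> and \<open>y\<^sub>i\<close> for \<open>i \<ge> 1\<close> are
  \<open>xvar i\<close> and \<open>yvar i\<close>, and \<open>xvar 0\<close>, \<open>yvar 0\<close> are further variables.\<close>

datatype var = xvar nat | yvar nat

text \<open>A word is a nonempty multiset of variables; the empty multiset is the empty word.\<close>

type_synonym word = "var multiset"

definition terms :: "word set set" where
  "terms = {t. finite t \<and> t \<noteq> {} \<and> {#} \<notin> t}"

definition term_mult :: "word set \<Rightarrow> word set \<Rightarrow> word set" where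
  "term_mult s t = {v + w | v w. v \<in> s \<and> w \<in> t}"

definition Pf :: "word set sr" where
  "Pf = \<lparr>carrier = terms, add = (\<union>), mult = term_mult\<rparr>"

lemma comm_ai_semiring_Pf: "comm_ai_semiring Pf"
proof
  have "{{#xvar 0#}} \<in> terms" by (simp add: terms_def)
  then show "carrier Pf \<noteq> {}" by (auto simp: Pf_def)
next
  fix a b assume "a \<in> carrier Pf" "b \<in> carrier Pf"
  moreover have "term_mult a b = (\<lambda>(v, w). v + w) ` (a \<times> b)"
    by (auto simp: term_mult_def)
  ultimately show "mult Pf a b \<in> carrier Pf"
    by (auto simp: Pf_def terms_def)
next
  fix a b c
  show "mult Pf (mult Pf a b) c = mult Pf a (mult Pf b c)"
    by (auto simp: Pf_def term_mult_def) (metis add.assoc)+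
next
  fix a b
  show "mult Pf a b = mult Pf b a"
    by (auto simp: Pf_def term_mult_def) (metis add.commute)+
qed (auto simp: Pf_def terms_def term_mult_def)

abbreviation substitutions :: "(word set \<Rightarrow> word set) set" where
  "substitutions \<equiv> sr_hom Pf Pf"

text \<open>In \<open>is_free v u\<close> (``\<open>v\<close> is \<open>u\<close>-free''), \<open>p\<close> is a term or the empty word, the latter as
  the formal sum \<open>{{#}}\<close>, and \<open>r\<close> is a term or the empty set.\<close>

definition is_free :: "word set \<Rightarrow> word set \<Rightarrow> bool" where
  "is_free v u \<longleftrightarrow> \<not> (\<exists>\<phi> p r. \<phi> \<in> substitutions \<and>
     p \<in> insert {{#}} terms \<and> r \<in> insert {} terms \<and> v = term_mult p (\<phi> u) \<union> r)"

section \<open>Identities, varieties and equational bases\<close>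

type_synonym identity = "word set \<times> word set"

definition satisfies :: "'a sr \<Rightarrow> identity \<Rightarrow> bool" where
  "satisfies S e \<longleftrightarrow> (\<forall>h\<in>sr_hom Pf S. h (fst e) = h (snd e))"

text \<open>The inequality \<open>s \<preceq> t\<close> is the identity \<open>t \<approx> t + s\<close>.\<close>

definition ineq :: "word set \<Rightarrow> word set \<Rightarrow> identity" where
  "ineq s t = (t, t \<union> s)"

definition direct_power :: "'i set \<Rightarrow> 'a sr \<Rightarrow> ('i \<Rightarrow> 'a) sr" where
  "direct_power I S =
    \<lparr>carrier = I \<rightarrow>\<^sub>E carrier S,
     add = (\<lambda>f g. \<lambda>i\<in>I. add S (f i) (g i)),
     mult = (\<lambda>f g. \<lambda>i\<in>I. mult S (f i) (g i))\<rparr>"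

definition subalgebra :: "'a set \<Rightarrow> 'a sr \<Rightarrow> bool" where
  "subalgebra B S \<longleftrightarrow> B \<noteq> {} \<and> B \<subseteq> carrier S \<and>
     (\<forall>a\<in>B. \<forall>b\<in>B. add S a b \<in> B \<and> mult S a b \<in> B)"

text \<open>The variety \<open>V(S)\<close> generated by \<open>S\<close>: the homomorphic images of subalgebras of direct
  powers of \<open>S\<close>, here those whose elements are taken from the type \<open>'u\<close>. The index sets
  \<open>I :: ('u \<Rightarrow> 'a) set\<close> are no restriction: every such image \<open>T\<close> is a quotient of the relatively
  free algebra over the carrier of \<open>T\<close>, which is a subalgebra of the power of \<open>S\<close> indexed by
  the maps from the carrier of \<open>T\<close> to that of \<open>S\<close>.\<close>

definition variety :: "'a sr \<Rightarrow> 'u sr set" where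
  "variety S = {T. \<exists>(I :: ('u \<Rightarrow> 'a) set) B h.
     subalgebra B (direct_power I S) \<and>
     h \<in> sr_hom ((direct_power I S)\<lparr>carrier := B\<rparr>) T \<and> h ` B = carrier T}"

text \<open>\<open>\<Sigma>\<close> defines \<open>V(S)\<close> among the commutative ai-semirings. HOL cannot quantify over algebras of
  every type at once, so they range over those whose elements are taken from an infinite type
  \<open>'u\<close>. The truth value does not depend on \<open>'u\<close>, because equational classes are
  determined by their countable members.\<close>

definition defines_variety :: "'u::infinite itself \<Rightarrow> 'a sr \<Rightarrow> identity set \<Rightarrow> bool" where
  "defines_variety _ S \<Sigma> \<longleftrightarrow>
     {T :: 'u sr. comm_ai_semiring T \<and> (\<forall>e\<in>\<Sigma>. satisfies T e)} = variety S"

definition equational_basis :: "'u::infinite itself \<Rightarrow> 'a sr \<Rightarrow> identity set \<Rightarrow> bool" where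
  "equational_basis U S \<Sigma> \<longleftrightarrow>
     \<Sigma> \<subseteq> {ineq s t | s t. s \<in> terms \<and> t \<in> terms} \<and> defines_variety U S \<Sigma>"

definition nonfinitely_based :: "'u::infinite itself \<Rightarrow> 'a sr \<Rightarrow> bool" where
  "nonfinitely_based U S \<longleftrightarrow>
     \<not> (\<exists>\<Sigma>. finite \<Sigma> \<and> \<Sigma> \<subseteq> terms \<times> terms \<and> defines_variety U S \<Sigma>)"

section \<open>The inequalities \<open>\<sigma>\<^sub>n\<^sub>,\<^sub>1\<close>\<close>

definition xprod :: "nat \<Rightarrow> word" where
  "xprod n = image_mset xvar (mset_set {1..n})"

definition u1 :: "nat \<Rightarrow> word set" where
  "u1 n = {xprod n} \<union> {{#xvar 1, xvar (n + 1)#}}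
     \<union> {{#xvar i, yvar i, xvar (n + 1)#} | i. i \<in> {2..n}}"

definition q :: "nat \<Rightarrow> word set" where
  "q n = {xprod (n + 1)}"

definition sigma1 :: "nat \<Rightarrow> identity" where
  "sigma1 n = ineq (q n) (u1 n)"

definition Omega1 :: "identity set" where
  "Omega1 = {sigma1 n | n. n \<ge> 2}"

end

theory Submission
  imports Defs "HOL-Library.Set_Algebras" "HOL-Library.Countable_Set"
begin

text \<open>Call two terms equivalent if no context \<open>p \<phi>(_) + r\<close> takes the value \<open>u\<^sub>m\<^sub>,\<^sub>1\<close> at exactly one of
  them. This is a fully invariant congruence \<open>\<rho>\<^sub>m\<close>, and it contains \<open>s \<preceq> t\<close> as soon as
  \<open>u\<^sub>m\<^sub>,\<^sub>1\<close> is \<open>t\<close>-free; since \<open>u\<^sub>m\<^sub>,\<^sub>1\<close> is \<open>u\<^sub>n\<^sub>,\<^sub>1\<close>-free for \<open>n < m\<close>, every member of \<open>\<Sigma>\<close> lies in \<open>\<rho>\<^sub>m\<close> for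
  all large \<open>m\<close>. Hence the quotient of \<open>P\<^sub>f(X\<^sub>c\<^sup>+)\<close> by the fully invariant congruence of all pairs that
  eventually lie in \<open>\<rho>\<^sub>m\<close> is a model of \<open>\<Sigma>\<close>, so each identity of an equivalent \<open>\<Gamma>\<close> is
  eventually in \<open>\<rho>\<^sub>m\<close>. If \<open>\<Gamma>\<close> were finite, the quotient by a single \<open>\<rho>\<^sub>m\<close> with \<open>\<sigma>\<^sub>m\<^sub>,\<^sub>1 \<in> \<Sigma>\<close> would be a
  model of \<open>\<Gamma>\<close>, hence of \<open>\<sigma>\<^sub>m\<^sub>,\<^sub>1\<close>, although \<open>u\<^sub>m\<^sub>,\<^sub>1\<close> is isolated for \<open>\<rho>\<^sub>m\<close>.\<close>

section \<open>Substitutions\<close>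

text \<open>Words are multisets, so concatenation is multiset addition and the product of terms is
  the elementwise \<open>+\<close> of sets. This makes the laws of a commutative monoid and
  \<open>sum_mset\<close> available for products of terms.\<close>

lemma term_mult_eq_plus: "term_mult s t = s + t"
  by (auto simp: term_mult_def set_plus_def)

lemma union_terms: "\<lbrakk>a \<in> terms; b \<in> terms\<rbrakk> \<Longrightarrow> a \<union> b \<in> terms"
  by (auto simp: terms_def)

lemma plus_terms: "\<lbrakk>a \<in> terms; b \<in> terms\<rbrakk> \<Longrightarrow> a + b \<in> terms"
  by (auto simp: terms_def set_plus_def finite_set_plus[unfolded set_plus_def])

lemma singleton_terms: "{w} \<in> terms \<longleftrightarrow> w \<noteq> {#}"
  by (auto simp: terms_def)

lemma set_plus_Un: "(A :: word set) + (B \<union> C) = (A + B) \<union> (A + C)"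
  by (auto simp: set_plus_def)

lemma Un_set_plus: "(B \<union> C) + (A :: word set) = (B + A) \<union> (C + A)"
  by (auto simp: set_plus_def)

lemma hom_Pf_union:
  "\<lbrakk>h \<in> sr_hom Pf T; a \<in> terms; b \<in> terms\<rbrakk> \<Longrightarrow> h (a \<union> b) = add T (h a) (h b)"
  by (simp add: sr_hom_def Pf_def)

lemma hom_Pf_plus:
  "\<lbrakk>h \<in> sr_hom Pf T; a \<in> terms; b \<in> terms\<rbrakk> \<Longrightarrow> h (a + b) = mult T (h a) (h b)"
  by (simp add: sr_hom_def Pf_def term_mult_eq_plus)

lemma hom_Pf_closed: "\<lbrakk>h \<in> sr_hom Pf T; a \<in> terms\<rbrakk> \<Longrightarrow> h a \<in> carrier T"
  by (auto simp: sr_hom_def Pf_def)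

lemma subst_union:
  "\<lbrakk>\<phi> \<in> substitutions; a \<in> terms; b \<in> terms\<rbrakk> \<Longrightarrow> \<phi> (a \<union> b) = \<phi> a \<union> \<phi> b"
  using hom_Pf_union[of \<phi> Pf a b] by (simp add: Pf_def)

lemma subst_plus:
  "\<lbrakk>\<phi> \<in> substitutions; a \<in> terms; b \<in> terms\<rbrakk> \<Longrightarrow> \<phi> (a + b) = \<phi> a + \<phi> b"
  using hom_Pf_plus[of \<phi> Pf a b] by (simp add: Pf_def term_mult_eq_plus)

lemma subst_terms: "\<lbrakk>\<phi> \<in> substitutions; a \<in> terms\<rbrakk> \<Longrightarrow> \<phi> a \<in> terms"
  using hom_Pf_closed[of \<phi> Pf a] by (simp add: Pf_def)

lemma substI:
  assumes "\<And>a. a \<in> terms \<Longrightarrow> \<phi> a \<in> terms"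
    and "\<And>a b. \<lbrakk>a \<in> terms; b \<in> terms\<rbrakk> \<Longrightarrow> \<phi> (a \<union> b) = \<phi> a \<union> \<phi> b"
    and "\<And>a b. \<lbrakk>a \<in> terms; b \<in> terms\<rbrakk> \<Longrightarrow> \<phi> (a + b) = \<phi> a + \<phi> b"
  shows "\<phi> \<in> substitutions"
  using assms by (simp add: sr_hom_def Pf_def term_mult_eq_plus)

lemma subst_id: "(\<lambda>a. a) \<in> substitutions"
  by (rule substI) auto

lemma hom_comp_subst:
  "\<lbrakk>\<phi> \<in> substitutions; h \<in> sr_hom Pf T\<rbrakk> \<Longrightarrow> (\<lambda>a. h (\<phi> a)) \<in> sr_hom Pf T"
  by (simp add: sr_hom_def Pf_def Pi_iff)

text \<open>The variables generate \<open>Pf\<close>: a nonempty word is a product of variables, and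
  a term is a finite nonempty union of singleton words. The two inductions follow these two
  layers.\<close>

lemma hom_eq_on_terms:
  assumes h: "h \<in> sr_hom Pf T" and k: "k \<in> sr_hom Pf T"
    and vars: "\<And>x. h {{#x#}} = k {{#x#}}" and t: "t \<in> terms"
  shows "h t = k t"
proof -
  have word: "h {w} = k {w}" if "w \<noteq> {#}" for w
    using that
  proof (induction w)
    case (add x w)
    show ?case
    proof (cases "w = {#}")
      case False
      have "{add_mset x w} = {{#x#}} + {w}" by (auto simp: set_plus_def)
      with False add.IH vars show ?thesis
        by (simp add: hom_Pf_plus[OF h] hom_Pf_plus[OF k] singleton_terms)
    qed (simp add: vars)
  qed simp
  have "finite t" "t \<noteq> {}" "{#} \<notin> t" using t by (auto simp: terms_def)
  then show ?thesis
  proof (induction t rule: finite_ne_induct)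
    case (insert w t)
    then have "{w} \<in> terms" "t \<in> terms" by (auto simp: terms_def)
    with insert word show ?case
      using hom_Pf_union[OF h, of "{w}" t] hom_Pf_union[OF k, of "{w}" t] by auto
  qed (simp add: word)
qed

text \<open>The endomorphism of the free algebra determined by the images \<open>f x\<close> of the
  variables. The inner sum runs in the monoid of sets of words, so it is the product of the terms
  \<open>f x\<close> along \<open>w\<close>.\<close>

definition extend :: "(var \<Rightarrow> word set) \<Rightarrow> word set \<Rightarrow> word set" where
  "extend f t = (\<Union>w\<in>t. \<Sum>x\<in>#w. f x)"

lemma extend_subst:
  assumes f: "\<And>x. f x \<in> terms"
  shows "extend f \<in> substitutions"
proof (rule substI)
  have word: "(\<Sum>x\<in>#w. f x) \<in> terms" if "w \<noteq> {#}" for w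
    using that
  proof (induction w)
    case (add x w)
    then show ?case using f plus_terms by (cases "w = {#}") auto
  qed simp
  fix a b :: "word set"
  show "extend f a \<in> terms" if "a \<in> terms"
  proof -
    have "(\<Sum>x\<in>#w. f x) \<in> terms" if "w \<in> a" for w
      using word[of w] that \<open>a \<in> terms\<close> by (auto simp: terms_def)
    then show ?thesis using that by (auto simp: extend_def terms_def)
  qed
  show "extend f (a \<union> b) = extend f a \<union> extend f b"
    by (simp add: extend_def)
  show "extend f (a + b) = extend f a + extend f b"
  proof -
    have "extend f (a + b) = (\<Union>v\<in>a. \<Union>w\<in>b. (\<Sum>x\<in>#v. f x) + (\<Sum>x\<in>#w. f x))"
      unfolding extend_def image_mset_union[symmetric] sum_mset.union[symmetric] set_plus_def[of a b]
      by blast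
    also have "\<dots> = extend f a + extend f b"
      unfolding extend_def set_plus_def by blast
    finally show ?thesis .
  qed
qed

lemma extend_var: "extend f {{#x#}} = f x"
  by (simp add: extend_def)

text \<open>Expanding the product of the images of the letters of \<open>w\<close> gives, among
  other words, the product of any chosen words \<open>A x\<close>. This replaces a substitution by
  terms with one by single words.\<close>

lemma subst_word_mem:
  assumes \<phi>: "\<phi> \<in> substitutions" and t: "t \<in> terms" and w: "w \<in> t"
    and A: "\<And>x. A x \<in> \<phi> {{#x#}}"
  shows "(\<Sum>x\<in>#w. A x) \<in> \<phi> t"
proof -
  have *: "(\<Sum>x\<in>#w. A x) \<in> \<phi> {w}" if "w \<noteq> {#}" for w
    using that
  proof (induction w)
    case (add x w)
    show ?case
    proof (cases "w = {#}")
      case False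
      have "{add_mset x w} = {{#x#}} + {w}" by (auto simp: set_plus_def)
      with False add.IH A show ?thesis
        by (simp add: subst_plus[OF \<phi>] singleton_terms set_plus_intro)
    qed (simp add: A)
  qed simp
  have "w \<noteq> {#}" using t w by (auto simp: terms_def)
  moreover have "\<phi> t = \<phi> {w} \<union> \<phi> t"
    using subst_union[OF \<phi> _ t, of "{w}"] \<open>w \<noteq> {#}\<close> w by (simp add: singleton_terms insert_absorb)
  ultimately show ?thesis using * by blast
qed

section \<open>Fully invariant congruences and their quotients\<close>

text \<open>Compatibility on one side suffices because both operations are commutative.\<close>

definition fully_invariant :: "identity set \<Rightarrow> bool" where
  "fully_invariant \<rho> \<longleftrightarrow> equiv terms \<rho> \<and>
     (\<forall>(a, b)\<in>\<rho>. (\<forall>c\<in>terms. (a \<union> c, b \<union> c) \<in> \<rho> \<and> (a + c, b + c) \<in> \<rho>) \<and>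
        (\<forall>\<phi>\<in>substitutions. (\<phi> a, \<phi> b) \<in> \<rho>))"

instance var :: countable
  by countable_datatype

text \<open>Quotients of \<open>Pf\<close> have to be realized inside an arbitrary infinite type.
  There are only countably many terms, being finite sets of words, and words are images of lists
  over a countable set.\<close>

lemma ex_inj_on_terms: "\<exists>f :: word set \<Rightarrow> 'u::infinite. inj_on f terms"
proof -
  have "countable (range (mset :: var list \<Rightarrow> word))" by blast
  then have "countable {t :: word set. finite t \<and> t \<subseteq> UNIV}"
    unfolding surj_mset by (rule countable_Collect_finite_subset)
  then have "countable terms"
    by (rule countable_subset[rotated]) (auto simp: terms_def)
  then obtain g :: "word set \<Rightarrow> nat" where "inj_on g terms"
    by (auto simp: countable_def)
  moreover obtain k :: "nat \<Rightarrow> 'u" where "inj k"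
    using infinite_countable_subset[OF infinite_UNIV] by blast
  ultimately show ?thesis
    by (meson comp_inj_on inj_on_subset subset_UNIV)
qed

text \<open>\<open>T\<close> is a copy of the quotient of \<open>Pf\<close> by
  \<open>\<rho>\<close>. The projection refutes every pair outside \<open>\<rho>\<close>; conversely
  every homomorphism into \<open>T\<close> factors through a substitution, under which
  \<open>\<rho>\<close> is invariant.\<close>

lemma fully_invariant_quotient:
  assumes \<rho>: "fully_invariant \<rho>"
  obtains T :: "'u::infinite sr"
  where "comm_ai_semiring T"
    and "\<And>a b. \<lbrakk>a \<in> terms; b \<in> terms\<rbrakk> \<Longrightarrow> satisfies T (a, b) \<longleftrightarrow> (a, b) \<in> \<rho>"
proof -
  obtain i :: "word set \<Rightarrow> 'u" where i: "inj_on i terms"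
    using ex_inj_on_terms by blast
  \<comment> \<open>Equivalent terms have the same candidates \<open>b\<close>, so the choice
    operator returns the same representative for both; \<open>f\<close> names the class of a term by
    an element of \<open>'u\<close>.\<close>
  define rep where "rep a = (SOME b. (a, b) \<in> \<rho>)" for a
  define f where "f a = i (rep a)" for a
  have eq: "equiv terms \<rho>" using \<rho> by (simp add: fully_invariant_def)
  have sub: "\<rho> \<subseteq> terms \<times> terms" using eq by (simp add: equiv_def refl_on_def)
  have rep: "(a, rep a) \<in> \<rho>" if "a \<in> terms" for a
    unfolding rep_def by (rule someI[of _ a]) (use eq that in \<open>auto simp: equiv_def refl_on_def\<close>)
  have f_eq: "f a = f b \<longleftrightarrow> (a, b) \<in> \<rho>" if "a \<in> terms" "b \<in> terms" for a b
  proof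
    assume "f a = f b"
    moreover have "rep a \<in> terms" "rep b \<in> terms" using rep that sub by blast+
    ultimately have "rep a = rep b" using i by (simp add: f_def inj_on_def)
    then show "(a, b) \<in> \<rho>" using rep[OF that(1)] rep[OF that(2)] eq
      by (metis equiv_def symD transD)
  next
    assume "(a, b) \<in> \<rho>"
    then have "(a, c) \<in> \<rho> \<longleftrightarrow> (b, c) \<in> \<rho>" for c
      using eq by (meson equiv_def symD transD)
    then show "f a = f b" by (simp add: f_def rep_def)
  qed
  define g where "g = inv_into terms f"
  have g: "g (f a) \<in> terms" "(g (f a), a) \<in> \<rho>" if "a \<in> terms" for a
  proof -
    have *: "f a \<in> f ` terms" using that by simp
    show "g (f a) \<in> terms" unfolding g_def by (rule inv_into_into[OF *])
    then show "(g (f a), a) \<in> \<rho>" using f_inv_into_f[OF *] f_eq that by (simp add: g_def)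
  qed
  define T where "T = \<lparr>carrier = f ` terms, add = (\<lambda>x y. f (g x \<union> g y)),
    mult = (\<lambda>x y. f (g x + g y))\<rparr>"
  have cong: "(a \<union> b, a' \<union> b') \<in> \<rho>" "(a + b, a' + b') \<in> \<rho>"
    if "(a, a') \<in> \<rho>" "(b, b') \<in> \<rho>" for a a' b b'
  proof -
    have t: "a \<in> terms" "a' \<in> terms" "b \<in> terms" "b' \<in> terms" using that sub by auto
    have 1: "(a \<union> b, a' \<union> b) \<in> \<rho>" "(a + b, a' + b) \<in> \<rho>"
      using \<rho> that(1) t(3) by (auto simp: fully_invariant_def)
    have 2: "(b \<union> a', b' \<union> a') \<in> \<rho>" "(b + a', b' + a') \<in> \<rho>"
      using \<rho> that(2) t(2) by (auto simp: fully_invariant_def)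
    have "trans \<rho>" using eq by (simp add: equiv_def)
    with 1 2 show "(a \<union> b, a' \<union> b') \<in> \<rho>" "(a + b, a' + b') \<in> \<rho>"
      by (metis Un_commute add.commute transD)+
  qed
  have f_add: "add T (f a) (f b) = f (a \<union> b)" and f_mult: "mult T (f a) (f b) = f (a + b)"
    if "a \<in> terms" "b \<in> terms" for a b
    using that cong[OF g(2)[OF that(1)] g(2)[OF that(2)]] g(1) f_eq
    by (simp_all add: T_def union_terms plus_terms)
  have carrier: "carrier T = f ` terms" by (simp add: T_def)
  have f_hom: "f \<in> sr_hom Pf T"
    by (simp add: sr_hom_def Pf_def carrier f_add f_mult term_mult_eq_plus)
  have "comm_ai_semiring T"
  proof
    show "carrier T \<noteq> {}"
      using singleton_terms[of "{#xvar 0#}"] by (auto simp: carrier)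
  qed (auto simp: carrier f_add f_mult union_terms plus_terms set_plus_Un Un_set_plus ac_simps)
  moreover have "satisfies T (a, b) \<longleftrightarrow> (a, b) \<in> \<rho>" if ab: "a \<in> terms" "b \<in> terms" for a b
  proof
    assume "satisfies T (a, b)"
    then have "f a = f b" using f_hom by (simp add: satisfies_def)
    with ab f_eq show "(a, b) \<in> \<rho>" by simp
  next
    assume \<rho>ab: "(a, b) \<in> \<rho>"
    have "h a = h b" if h: "h \<in> sr_hom Pf T" for h
    proof -
      \<comment> \<open>Lift \<open>h\<close> through the projection \<open>f\<close>: send each
        variable to some term in the class \<open>h {{#x#}}\<close>. Then \<open>f\<close> after
        \<open>\<phi>\<close> agrees with \<open>h\<close> on variables, hence everywhere.\<close>
      define \<phi> where "\<phi> = extend (\<lambda>x. g (h {{#x#}}))"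
      have hx: "h {{#x#}} \<in> f ` terms" for x
        using hom_Pf_closed[OF h, of "{{#x#}}"] by (simp add: carrier singleton_terms)
      then have "g (h {{#x#}}) \<in> terms" for x unfolding g_def by (rule inv_into_into)
      then have \<phi>: "\<phi> \<in> substitutions" unfolding \<phi>_def by (rule extend_subst)
      have "f (\<phi> {{#x#}}) = h {{#x#}}" for x
        unfolding \<phi>_def extend_var g_def by (rule f_inv_into_f[OF hx])
      then have *: "f (\<phi> t) = h t" if "t \<in> terms" for t
        using hom_eq_on_terms[OF hom_comp_subst[OF \<phi> f_hom] h _ that] by simp
      have "(\<phi> a, \<phi> b) \<in> \<rho>" using \<rho> \<rho>ab \<phi> by (auto simp: fully_invariant_def)
      then show ?thesis using * ab f_eq subst_terms[OF \<phi>] by metis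
    qed
    then show "satisfies T (a, b)" by (simp add: satisfies_def)
  qed
  ultimately show ?thesis by (rule that)
qed

text \<open>Each closure condition has at most two premises, and two properties that hold eventually
  hold eventually together.\<close>

lemma fully_invariant_eventually:
  fixes \<rho> :: "nat \<Rightarrow> identity set"
  assumes "\<And>m. fully_invariant (\<rho> m)"
  shows "fully_invariant {e. \<forall>\<^sub>F m in sequentially. e \<in> \<rho> m}" (is "fully_invariant ?L")
proof -
  have eq: "equiv terms (\<rho> m)" for m using assms by (simp add: fully_invariant_def)
  have "equiv terms ?L"
  proof (rule equivI)
    show "?L \<subseteq> terms \<times> terms"
    proof
      fix e assume "e \<in> ?L"
      then obtain m where "e \<in> \<rho> m" by (auto simp: eventually_sequentially)
      then show "e \<in> terms \<times> terms" using eq[of m] by (auto simp: equiv_def refl_on_def)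
    qed
    show "refl_on terms ?L"
      using eq by (simp add: equiv_def refl_on_def)
    show "sym ?L"
    proof (rule symI)
      fix a b assume "(a, b) \<in> ?L"
      then have "\<forall>\<^sub>F m in sequentially. (a, b) \<in> \<rho> m" by simp
      then have "\<forall>\<^sub>F m in sequentially. (b, a) \<in> \<rho> m"
        by (rule eventually_mono) (meson eq equiv_def symD)
      then show "(b, a) \<in> ?L" by simp
    qed
    show "trans ?L"
    proof (rule transI)
      fix a b c assume "(a, b) \<in> ?L" "(b, c) \<in> ?L"
      then have "\<forall>\<^sub>F m in sequentially. (a, b) \<in> \<rho> m" "\<forall>\<^sub>F m in sequentially. (b, c) \<in> \<rho> m"
        by simp_all
      then have "\<forall>\<^sub>F m in sequentially. (a, c) \<in> \<rho> m"
        by (rule eventually_elim2) (meson eq equiv_def transD)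
      then show "(a, c) \<in> ?L" by simp
    qed
  qed
  moreover have "(a \<union> c, b \<union> c) \<in> ?L \<and> (a + c, b + c) \<in> ?L"
    if "(a, b) \<in> ?L" and c: "c \<in> terms" for a b c
  proof -
    have "(a \<union> c, b \<union> c) \<in> \<rho> m" "(a + c, b + c) \<in> \<rho> m" if "(a, b) \<in> \<rho> m" for m
      using assms[of m] that c by (auto simp: fully_invariant_def)
    with \<open>(a, b) \<in> ?L\<close> show ?thesis by (simp add: eventually_mono)
  qed
  moreover have "(\<phi> a, \<phi> b) \<in> ?L" if "(a, b) \<in> ?L" and \<phi>: "\<phi> \<in> substitutions" for a b \<phi>
  proof -
    have "(\<phi> a, \<phi> b) \<in> \<rho> m" if "(a, b) \<in> \<rho> m" for m
      using assms[of m] that \<phi> by (auto simp: fully_invariant_def)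
    with \<open>(a, b) \<in> ?L\<close> show ?thesis by (simp add: eventually_mono)
  qed
  ultimately show ?thesis unfolding fully_invariant_def by blast
qed

section \<open>The congruence of terms that contexts with value \<open>v\<close> cannot
  separate\<close>

definition context_congruence :: "word set \<Rightarrow> identity set" where
  "context_congruence v = {(a, b). a \<in> terms \<and> b \<in> terms \<and>
     (\<forall>\<phi>\<in>substitutions. \<forall>p\<in>insert {{#}} terms. \<forall>r\<in>insert {} terms.
        v = p + \<phi> a \<union> r \<longleftrightarrow> v = p + \<phi> b \<union> r)}"

lemma context_congruenceI:
  assumes "a \<in> terms" "b \<in> terms"
    and "\<And>\<phi> p r. \<lbrakk>\<phi> \<in> substitutions; p \<in> insert {{#}} terms; r \<in> insert {} terms\<rbrakk>
      \<Longrightarrow> v = p + \<phi> a \<union> r \<longleftrightarrow> v = p + \<phi> b \<union> r"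
  shows "(a, b) \<in> context_congruence v"
  unfolding context_congruence_def
  by (intro CollectI case_prodI conjI ballI assms)

lemma context_congruenceD:
  "\<lbrakk>(a, b) \<in> context_congruence v; \<phi> \<in> substitutions; p \<in> insert {{#}} terms; r \<in> insert {} terms\<rbrakk>
    \<Longrightarrow> v = p + \<phi> a \<union> r \<longleftrightarrow> v = p + \<phi> b \<union> r"
  unfolding context_congruence_def
  by (drule CollectD, drule case_prodD, elim conjE) (drule (1) bspec)+

lemma prefix_plus_terms: "\<lbrakk>p \<in> insert {{#}} terms; c \<in> terms\<rbrakk> \<Longrightarrow> p + c \<in> terms"
  using plus_terms[of p c] by (cases "p = {{#}}") (simp_all add: set_plus_def)

text \<open>Contexts are closed under composition: a summand \<open>c\<close> is absorbed into the
  remainder as \<open>p + \<phi> c\<close>, a factor \<open>c\<close> into the prefix as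
  \<open>\<phi> c\<close>, and an inner substitution into \<open>\<phi>\<close>.\<close>

lemma fully_invariant_context_congruence: "fully_invariant (context_congruence v)"
proof -
  have "equiv terms (context_congruence v)"
    by (rule equivI) (auto simp: context_congruence_def refl_on_def sym_def trans_def)
  moreover have "(a \<union> c, b \<union> c) \<in> context_congruence v" "(a + c, b + c) \<in> context_congruence v"
    if ab: "(a, b) \<in> context_congruence v" and c: "c \<in> terms" for a b c
  proof -
    have t: "a \<in> terms" "b \<in> terms" using ab by (auto simp: context_congruence_def)
    {
      fix \<phi> p r
      assume *: "\<phi> \<in> substitutions" "p \<in> insert {{#}} terms" "r \<in> insert {} terms"
      have \<phi>c: "\<phi> c \<in> terms" using subst_terms *(1) c .
      have "p + \<phi> c \<union> r \<in> insert {} terms"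
        using prefix_plus_terms[OF *(2) \<phi>c] *(3) union_terms by auto
      from context_congruenceD[OF ab *(1,2) this]
      have "v = p + \<phi> (a \<union> c) \<union> r \<longleftrightarrow> v = p + \<phi> (b \<union> c) \<union> r"
        by (simp add: subst_union[OF *(1)] t c set_plus_Un Un_assoc)
      moreover from context_congruenceD[OF ab *(1) _ *(3)] prefix_plus_terms[OF *(2) \<phi>c]
      have "v = (p + \<phi> c) + \<phi> a \<union> r \<longleftrightarrow> v = (p + \<phi> c) + \<phi> b \<union> r" by blast
      then have "v = p + \<phi> (a + c) \<union> r \<longleftrightarrow> v = p + \<phi> (b + c) \<union> r"
        by (simp add: subst_plus[OF *(1)] t c ac_simps)
      ultimately have "v = p + \<phi> (a \<union> c) \<union> r \<longleftrightarrow> v = p + \<phi> (b \<union> c) \<union> r"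
        "v = p + \<phi> (a + c) \<union> r \<longleftrightarrow> v = p + \<phi> (b + c) \<union> r" .
    }
    note * = this
    show "(a \<union> c, b \<union> c) \<in> context_congruence v"
      by (rule context_congruenceI[OF _ _ *(1)]) (use t c union_terms in auto)
    show "(a + c, b + c) \<in> context_congruence v"
      by (rule context_congruenceI[OF _ _ *(2)]) (use t c plus_terms in auto)
  qed
  moreover have "(\<phi> a, \<phi> b) \<in> context_congruence v"
    if ab: "(a, b) \<in> context_congruence v" and \<phi>: "\<phi> \<in> substitutions" for a b \<phi>
    by (rule context_congruenceI[OF _ _ context_congruenceD[OF ab hom_comp_subst[OF \<phi>]]])
      (use ab subst_terms[OF \<phi>] in \<open>auto simp: context_congruence_def\<close>)
  ultimately show ?thesis by (auto simp: fully_invariant_def)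
qed

text \<open>Both sides of the required equivalence are false. A context with value \<open>v\<close>
  at \<open>t \<union> s\<close> would become one at \<open>t\<close> after moving
  \<open>p + \<phi> s\<close> into the remainder, against freeness.\<close>

lemma ineq_in_context_congruence:
  assumes s: "s \<in> terms" and t: "t \<in> terms" and free: "is_free v t"
  shows "ineq s t \<in> context_congruence v"
proof -
  have no: "v \<noteq> p + \<phi> t \<union> r"
    if "\<phi> \<in> substitutions" "p \<in> insert {{#}} terms" "r \<in> insert {} terms" for \<phi> p r
    using free that unfolding is_free_def term_mult_eq_plus by blast
  have no': "v \<noteq> p + \<phi> (t \<union> s) \<union> r"
    if *: "\<phi> \<in> substitutions" "p \<in> insert {{#}} terms" "r \<in> insert {} terms" for \<phi> p r
  proof -
    have "p + \<phi> s \<union> r \<in> insert {} terms"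
      using prefix_plus_terms[OF *(2) subst_terms[OF *(1) s]] *(3) union_terms by auto
    from no[OF *(1,2) this] show ?thesis
      by (simp add: subst_union[OF *(1) t s] set_plus_Un Un_assoc)
  qed
  show ?thesis
    unfolding ineq_def
    by (rule context_congruenceI) (use no no' s t union_terms in \<open>simp_all del: insert_iff\<close>)
qed

text \<open>The trivial context (identity substitution, empty prefix, empty remainder) already
  separates \<open>v\<close> from every other term.\<close>

lemma isolated_in_context_congruence:
  assumes "(v, b) \<in> context_congruence v"
  shows "b = v"
  using context_congruenceD[OF assms subst_id, of "{{#}}" "{}"] by (simp add: set_plus_def)

section \<open>The terms \<open>u\<^sub>m\<^sub>,\<^sub>1\<close>\<close>

lemma xprod_Suc: "xprod (Suc n) = add_mset (xvar (Suc n)) (xprod n)"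
  by (simp add: xprod_def atLeastAtMostSuc_conv)

lemma size_xprod: "size (xprod n) = n"
  by (simp add: xprod_def)

lemma set_mset_xprod: "set_mset (xprod n) = xvar ` {1..n}"
  by (simp add: xprod_def)

lemma count_xprod_le_1: "count (xprod n) x \<le> 1"
proof (induction n)
  case (Suc n)
  have "count (xprod n) (xvar (Suc n)) = 0"
    unfolding count_eq_zero_iff set_mset_xprod by auto
  with Suc show ?case by (auto simp: xprod_Suc)
qed (simp add: xprod_def)

lemma u1_terms: "n \<ge> 1 \<Longrightarrow> u1 n \<in> terms"
  using size_xprod[of n] by (auto simp: terms_def u1_def)

lemma q_terms: "q n \<in> terms"
  by (simp add: q_def singleton_terms xprod_Suc)

lemma u1_cases:
  assumes "w \<in> u1 m"
  obtains "w = xprod m" | "w = {#xvar 1, xvar (Suc m)#}"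
  | j where "2 \<le> j" "j \<le> m" "w = {#xvar j, yvar j, xvar (Suc m)#}"
  using assms by (auto simp: u1_def)

lemma count_u1_le_1: "\<lbrakk>w \<in> u1 m; m \<ge> 1\<rbrakk> \<Longrightarrow> count w x \<le> 1"
  by (erule u1_cases) (auto simp: count_xprod_le_1[simplified])

text \<open>Lengths decide: the words of \<open>u1 m\<close> have length \<open>m\<close>, 2 or 3,
  none of which is \<open>m + 1\<close>.\<close>

lemma q_not_in_u1: "m \<ge> 4 \<Longrightarrow> xprod (Suc m) \<notin> u1 m"
proof
  assume m: "m \<ge> 4" and mem: "xprod (Suc m) \<in> u1 m"
  have size: "size (xprod (Suc m)) = Suc m" by (rule size_xprod)
  show False
    using mem by (cases rule: u1_cases) (use size m in \<open>simp_all add: size_xprod\<close>)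
qed

lemma size_u1_xvar_Suc: "\<lbrakk>w \<in> u1 m; xvar (Suc m) \<in># w\<rbrakk> \<Longrightarrow> size w \<le> 3"
  by (erule u1_cases) (auto simp: set_mset_xprod)

text \<open>All words of \<open>u1 m\<close> are linear, so \<open>M\<close> contains two different
  variables, whereas two different words of \<open>u1 m\<close> have at most one variable in
  common.\<close>

lemma u1_words_meet:
  assumes "w \<in> u1 m" "w' \<in> u1 m" "m \<ge> 1"
    and M: "M \<subseteq># w" "M \<subseteq># w'" "size M \<ge> 2"
  shows "w = w'"
proof -
  obtain x N where N: "M = add_mset x N" "size N \<ge> 1"
    using M(3) by (cases M) auto
  then obtain y N' where "N = add_mset y N'" by (cases N) auto
  with N have M_eq: "M = add_mset x (add_mset y N')" by simp
  have "count M x \<le> 1"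
    using count_u1_le_1[OF assms(1,3), of x] M(1) by (meson mset_subset_eq_count order_trans)
  with M_eq have "x \<noteq> y" by auto
  moreover have "x \<in># w" "x \<in># w'" "y \<in># w" "y \<in># w'"
    using M M_eq by (auto dest: mset_subset_eqD)
  ultimately show ?thesis
    using assms(1,2) by (elim u1_cases) (auto simp: set_mset_xprod)
qed

text \<open>The combinatorial core. Overlaps of images force \<open>p\<close> to be empty and the
  images of \<open>xvar 1\<close> and \<open>xvar (Suc n)\<close> to be the two letters of the
  unique word of length 2 in \<open>u1 m\<close>. Either order of these letters is then
  contradictory.\<close>

lemma no_embedding_u1:
  fixes p :: word and A :: "var \<Rightarrow> word"
  assumes n: "2 \<le> n" "n < m" and m: "4 \<le> m"
    and ne: "\<And>x. A x \<noteq> {#}"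
    and embed: "\<And>w. w \<in> u1 n \<Longrightarrow> p + (\<Sum>x\<in>#w. A x) \<in> u1 m"
  shows False
proof -
  define a where "a = A (xvar 1)"
  define c where "c = A (xvar (Suc n))"
  define d where "d i = A (xvar i)" for i
  define b where "b i = A (yvar i)" for i
  define r where "r = (\<Sum>i\<in>{2..n}. d i)"
  have m1: "m \<ge> 1" using m by simp
  have "{1..n} = insert 1 {2..n}" using n by auto
  then have "(\<Sum>x\<in>#xprod n. A x) = a + r"
    by (simp add: xprod_def image_mset.compositionality o_def sum_unfold_sum_mset[symmetric] a_def r_def d_def)
  then have W1: "p + a + r \<in> u1 m"
    using embed[of "xprod n"] by (simp add: u1_def add.assoc)
  have W2: "p + a + c \<in> u1 m"
    using embed[of "{#xvar 1, xvar (Suc n)#}"] by (simp add: u1_def a_def c_def add.assoc)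
  have W3: "p + d i + b i + c \<in> u1 m" if "i \<in> {2..n}" for i
    using embed[of "{#xvar i, yvar i, xvar (Suc n)#}"] that
    by (auto simp: u1_def d_def b_def c_def add.assoc)
  have size_pos: "size a \<ge> 1" "size c \<ge> 1" "size (d i) \<ge> 1" "size (b i) \<ge> 1" for i
    using ne by (simp_all add: a_def b_def c_def d_def Suc_le_eq nonempty_has_size[symmetric])
  have disjoint: False if "i \<in> {2..n}" "x \<in># d i" "x \<in># c" for i x
  proof -
    have "count (p + d i + b i + c) x \<le> 1" by (rule count_u1_le_1[OF W3[OF that(1)] m1])
    moreover have "count (d i) x > 0" "count c x > 0" using that by (simp_all add: count_greater_zero_iff)
    ultimately show False by simp
  qed
  have r_mem: "\<exists>i\<in>{2..n}. x \<in># d i" if "x \<in># r" for x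
    using that by (auto simp: r_def set_mset_sum)
  \<comment> \<open>Every letter of \<open>r\<close> lies in some \<open>d i\<close>, and by
    linearity of the words in \<open>W3\<close> no \<open>d i\<close> shares a letter with the
    nonempty \<open>c\<close>.\<close>
  have "r \<noteq> c"
  proof
    assume "r = c"
    obtain x where "x \<in># c" using size_pos(2) by (cases c) auto
    with \<open>r = c\<close> r_mem disjoint show False by blast
  qed
  \<comment> \<open>The words in \<open>W1\<close> and \<open>W2\<close> share \<open>p + a\<close>;
    if that had two letters, the words would coincide and \<open>r = c\<close> would follow.\<close>
  then have "size (p + a) < 2"
    using u1_words_meet[OF W1 W2 m1, of "p + a"] by (metis add_left_cancel mset_subset_eq_add_left not_le)
  then have pa: "p = {#}" "size a = 1" using size_pos(1) by (auto simp flip: size_eq_0_iff_empty)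
  have "2 \<in> {2..n}" using n by simp
  \<comment> \<open>The same overlap argument for \<open>c\<close>, shared by \<open>W2\<close> and
    \<open>W3\<close> at \<open>i = 2\<close>: coincidence would make the single letter
    \<open>a\<close> equal to \<open>d 2 + b 2\<close>, of length at least 2.\<close>
  have "size c < 2"
  proof (rule ccontr)
    assume "\<not> size c < 2"
    then have "p + a + c = p + d 2 + b 2 + c"
      using u1_words_meet[OF W2 W3[OF \<open>2 \<in> {2..n}\<close>] m1, of c] by simp
    then have "size a = size (d 2) + size (b 2)"
      by (metis add_right_cancel add_left_cancel add.assoc size_union)
    with pa size_pos(3,4)[of 2] show False by simp
  qed
  then have "size c = 1" using size_pos(2) by simp
  with pa obtain s t where st: "a = {#s#}" "c = {#t#}"
    by (metis size_1_singleton_mset)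
  have t_r: "t \<notin># r" using r_mem disjoint st by fastforce
  have sr: "add_mset s r \<in> u1 m" using W1 pa st by simp
  have "{#s, t#} \<in> u1 m" using W2 pa st by (simp add: add_mset_commute)
  then have "{#s, t#} = {#xvar 1, xvar (Suc m)#}"
  proof (cases rule: u1_cases)
    case 1
    then have "size {#s, t#} = m" by (simp only: size_xprod)
    with m show ?thesis by simp
  next
    case (3 j)
    then have "size {#s, t#} = 3" by (simp only:) simp
    then show ?thesis by simp
  qed
  then consider "s = xvar 1" "t = xvar (Suc m)" | "s = xvar (Suc m)" "t = xvar 1"
    by (auto simp: add_eq_conv_ex)
  then show False
  proof cases
    case 1
    \<comment> \<open>The word in \<open>W1\<close> contains \<open>xvar 1\<close>, which leaves out
      the words of length 3; the word of length 2 would put \<open>t\<close> into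
      \<open>r\<close>.\<close>
    have "add_mset s r = xprod m"
      using sr
    proof (cases rule: u1_cases)
      case 2
      then show ?thesis using 1 t_r by simp
    next
      case (3 j)
      then have "xvar 1 \<in># {#xvar j, yvar j, xvar (Suc m)#}" using 1 by (metis union_single_eq_member)
      then show ?thesis using 3(1) m by auto
    qed
    then have "size r + 1 = m" using size_xprod[of m] by (metis size_add_mset Suc_eq_plus1)
    \<comment> \<open>The word in \<open>W3\<close> contains \<open>t = xvar (Suc m)\<close>, so it
      has at most three letters, and its nonempty parts \<open>d i\<close>, \<open>b i\<close>,
      \<open>c\<close> have one each. Hence \<open>r\<close> has length \<open>n - 1\<close>, but
      \<open>W1\<close> needs \<open>m - 1\<close>.\<close>
    have "size (d i) = 1" if "i \<in> {2..n}" for i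
      using size_u1_xvar_Suc[OF W3[OF that]] size_pos(3,4)[of i] 1 st by simp
    then have "size r = n - 1" by (simp add: r_def size_multiset_sum)
    with \<open>size r + 1 = m\<close> n show False by simp
  next
    case 2
    \<comment> \<open>With the letters swapped, the word in \<open>W1\<close> contains
      \<open>xvar (Suc m)\<close> but not \<open>xvar 1\<close>, so it has length 3. Its letter
      \<open>yvar j\<close> then occurs together with \<open>t = xvar 1\<close> in a word of
      \<open>W3\<close>, impossible for \<open>j \<ge> 2\<close>.\<close>
    obtain j where j: "add_mset s r = {#xvar j, yvar j, xvar (Suc m)#}" "2 \<le> j"
      using sr
    proof (cases rule: u1_cases)
      case 1
      then have "s \<in># xprod m" by (metis union_single_eq_member)
      then show ?thesis using 2 by (auto simp: set_mset_xprod)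
    next
      case _: 2
      then have "add_mset (xvar (Suc m)) r = add_mset (xvar (Suc m)) {#xvar 1#}"
        using 2 by (simp add: add_mset_commute)
      then show ?thesis using 2 t_r by simp
    qed (rule that)
    then have "yvar j \<in># add_mset s r" by simp
    then have "yvar j \<in># r" using 2 by simp
    then obtain i where "i \<in> {2..n}" "yvar j \<in># d i" using r_mem by blast
    then have "p + d i + b i + c \<in> u1 m" "yvar j \<in># p + d i + b i + c" "xvar 1 \<in># p + d i + b i + c"
      using W3 2 st by auto
    then show False
      using j(2) by (elim u1_cases) (auto simp: set_mset_xprod)
  qed
qed

text \<open>Choosing one word from \<open>p\<close> and one from the image of each variable turns a
  forbidden decomposition into an embedding by words; only the inclusion of
  \<open>p + \<phi> (u1 n)\<close> in \<open>u1 m\<close> is needed.\<close>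

lemma is_free_u1:
  assumes "2 \<le> n" "n < m" "4 \<le> m"
  shows "is_free (u1 m) (u1 n)"
  unfolding is_free_def term_mult_eq_plus
proof (intro notI, elim exE conjE)
  fix \<phi> p r
  assume \<phi>: "\<phi> \<in> substitutions" and p: "p \<in> insert {{#}} terms" and eq: "u1 m = p + \<phi> (u1 n) \<union> r"
  obtain v where v: "v \<in> p" using p by (auto simp: terms_def)
  have vars: "\<phi> {{#x#}} \<in> terms" for x
    using subst_terms[OF \<phi>] by (simp add: singleton_terms)
  then have "\<forall>x. \<exists>w. w \<in> \<phi> {{#x#}}" by (auto simp: terms_def)
  then obtain A where A: "\<And>x. A x \<in> \<phi> {{#x#}}" by metis
  have "u1 n \<in> terms" using assms by (intro u1_terms) simp
  show False
  proof (rule no_embedding_u1[OF assms])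
    show "A x \<noteq> {#}" for x using A vars by (metis (no_types, lifting) mem_Collect_eq terms_def)
    show "v + (\<Sum>x\<in>#w. A x) \<in> u1 m" if "w \<in> u1 n" for w
      using eq subst_word_mem[OF \<phi> \<open>u1 n \<in> terms\<close> that A] v by (simp add: set_plus_intro)
  qed
qed

section \<open>Contradiction from a finite basis\<close>

theorem theorem4p2:
  fixes S :: "'a sr" and \<Sigma> \<Delta> :: "identity set"
  assumes "comm_ai_semiring S"
    and "equational_basis TYPE('u::infinite) S \<Sigma>"
    and "\<Delta> \<subseteq> Omega1" and "infinite \<Delta>" and "\<Delta> \<subseteq> \<Sigma>"
    and "\<And>s t m. \<lbrakk>s \<in> terms; t \<in> terms; ineq s t \<in> \<Sigma> - Omega1; m \<ge> 4\<rbrakk> \<Longrightarrow> is_free (u1 m) t"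
  shows "nonfinitely_based TYPE('u) S"
  unfolding nonfinitely_based_def
proof
  assume "\<exists>\<Gamma>. finite \<Gamma> \<and> \<Gamma> \<subseteq> terms \<times> terms \<and> defines_variety TYPE('u) S \<Gamma>"
  then obtain \<Gamma> where \<Gamma>: "finite \<Gamma>" "\<Gamma> \<subseteq> terms \<times> terms" "defines_variety TYPE('u) S \<Gamma>"
    by blast
  have \<Sigma>: "\<Sigma> \<subseteq> {ineq s t | s t. s \<in> terms \<and> t \<in> terms}" "defines_variety TYPE('u) S \<Sigma>"
    using assms(2) by (simp_all add: equational_basis_def)
  then have \<Sigma>_terms: "\<Sigma> \<subseteq> terms \<times> terms"
    by (auto simp: ineq_def union_terms)
  have models: "(\<forall>e\<in>\<Sigma>. satisfies T e) \<longleftrightarrow> (\<forall>e\<in>\<Gamma>. satisfies T e)"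
    if "comm_ai_semiring T" for T :: "'u sr"
    using \<Gamma>(3) \<Sigma>(2) that unfolding defines_variety_def by blast
  \<comment> \<open>Two sets of identities with the same models lie in the same fully invariant
    congruences, since each such congruence is the set of identities of a model with elements in
    \<open>'u\<close>.\<close>
  have subset: "\<Sigma> \<subseteq> \<rho> \<longleftrightarrow> \<Gamma> \<subseteq> \<rho>" if \<rho>: "fully_invariant \<rho>" for \<rho>
  proof -
    obtain T :: "'u sr" where T: "comm_ai_semiring T"
      and sat: "\<And>a b. \<lbrakk>a \<in> terms; b \<in> terms\<rbrakk> \<Longrightarrow> satisfies T (a, b) \<longleftrightarrow> (a, b) \<in> \<rho>"
      using fully_invariant_quotient[OF \<rho>] by blast
    have "(\<forall>e\<in>E. satisfies T e) \<longleftrightarrow> E \<subseteq> \<rho>" if "E \<subseteq> terms \<times> terms" for E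
      using that sat by blast
    with models[OF T] \<Gamma>(2) \<Sigma>_terms show ?thesis by blast
  qed
  let ?\<rho> = "\<lambda>m. context_congruence (u1 m)"
  have "\<forall>\<^sub>F m in sequentially. e \<in> ?\<rho> m" if e: "e \<in> \<Sigma>" for e
  proof (cases "e \<in> Omega1")
    case True
    then obtain n where n: "e = sigma1 n" "n \<ge> 2" by (auto simp: Omega1_def)
    have "e \<in> ?\<rho> m" if "m \<ge> max 4 (Suc n)" for m
      unfolding n(1) sigma1_def
      by (rule ineq_in_context_congruence) (use n(2) that in \<open>auto intro!: q_terms u1_terms is_free_u1\<close>)
    then show ?thesis unfolding eventually_sequentially by blast
  next
    case False
    obtain s t where st: "e = ineq s t" "s \<in> terms" "t \<in> terms" using \<Sigma>(1) e by blast
    have "e \<in> ?\<rho> m" if "m \<ge> 4" for m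
      unfolding st(1)
      by (rule ineq_in_context_congruence[OF st(2,3)])
        (use assms(6)[OF st(2,3)] st(1) False \<open>e \<in> \<Sigma>\<close> that in blast)
    then show ?thesis unfolding eventually_sequentially by blast
  qed
  then have "\<Sigma> \<subseteq> {e. \<forall>\<^sub>F m in sequentially. e \<in> ?\<rho> m}" by blast
  then have "\<Gamma> \<subseteq> {e. \<forall>\<^sub>F m in sequentially. e \<in> ?\<rho> m}"
    using subset[OF fully_invariant_eventually[of ?\<rho>, OF fully_invariant_context_congruence]]
    by (rule iffD1[rotated])
  \<comment> \<open>Finiteness of \<open>\<Gamma>\<close> enters here: it yields one threshold
    \<open>N\<close> valid for all its identities.\<close>
  then have "\<forall>\<^sub>F m in sequentially. \<forall>e\<in>\<Gamma>. e \<in> ?\<rho> m"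
    by (intro eventually_ball_finite \<Gamma>(1)) blast
  then obtain N where N: "\<And>m. m \<ge> N \<Longrightarrow> \<Gamma> \<subseteq> ?\<rho> m"
    unfolding eventually_sequentially by blast
  \<comment> \<open>An infinite set of inequalities needs infinitely many indices, so some
    \<open>sigma1 m\<close> in \<open>\<Sigma>\<close> has \<open>m\<close> beyond
    \<open>N\<close>.\<close>
  have "\<Delta> \<subseteq> sigma1 ` {n. sigma1 n \<in> \<Delta>}"
    using assms(3) by (auto simp: Omega1_def)
  then have "infinite {n. sigma1 n \<in> \<Delta>}"
    using assms(4) by (meson finite_imageI finite_subset)
  then obtain m where m: "m > max 4 N" "sigma1 m \<in> \<Delta>"
    unfolding infinite_nat_iff_unbounded by blast
  have "\<Sigma> \<subseteq> ?\<rho> m"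
    using N[of m] m(1) subset fully_invariant_context_congruence by simp
  then have "(u1 m, u1 m \<union> q m) \<in> ?\<rho> m"
    using m(2) assms(5) by (auto simp: sigma1_def ineq_def)
  then have "u1 m \<union> q m = u1 m" by (rule isolated_in_context_congruence)
  then show False using q_not_in_u1[of m] m(1) by (auto simp: q_def)
qed

end
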